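(* For every integer $n\ge 4$ and for $n=2$, $$red(n) > rod(n).$$
   Context: A partition is a finite, nonempty, nonincreasing sequence of positive integers called its parts. The perimeter of a partition $\pi$ is $\alpha_\pi+\lambda_\pi-1$, where $\alpha_\pi$ is the largest part of $\pi$ and $\lambda_\pi$ is the number of parts of $\pi$ (counted with multiplicity). $red(n)$ is the number of partitions of perimeter $n$ in which the even parts are distinct (no even part is repeated; odd parts are unrestricted), and $rod(n)$ is the number of partitions of perimeter $n$ in which the odd parts are distinct (no odd part is repeated; even parts are unrestricted). *)

theory Defs
  imports Main
begin

definition is_partition :: "nat list \<Rightarrow> bool" where
  "is_partition p \<longleftrightarrow> p \<noteq> [] \<and> sorted_wrt (\<ge>) p \<and> (\<forall>x\<in>set p. x > 0)"

(* For a partition p the maximum is over a nonempty set of positive numbers,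
   so the subtraction does not truncate. *)
definition perimeter :: "nat list \<Rightarrow> nat" where
  "perimeter p = Max (set p) + length p - 1"

definition even_parts_distinct :: "nat list \<Rightarrow> bool" where
  "even_parts_distinct p \<longleftrightarrow> (\<forall>x\<in>set p. even x \<longrightarrow> count_list p x = 1)"

definition odd_parts_distinct :: "nat list \<Rightarrow> bool" where
  "odd_parts_distinct p \<longleftrightarrow> (\<forall>x\<in>set p. odd x \<longrightarrow> count_list p x = 1)"

definition red :: "nat \<Rightarrow> nat" where
  "red n = card {p. is_partition p \<and> perimeter p = n \<and> even_parts_distinct p}"

definition rod :: "nat \<Rightarrow> nat" where
  "rod n = card {p. is_partition p \<and> perimeter p = n \<and> odd_parts_distinct p}"

(* The sets counted by red and rod are finite, so card is the true cardinality. *)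
lemma finite_partitions_perimeter: "finite {p. is_partition p \<and> perimeter p = n}"
proof (rule finite_subset)
  show "{p. is_partition p \<and> perimeter p = n} \<subseteq> {p. set p \<subseteq> {..n} \<and> length p \<le> n}"
  proof
    fix p assume "p \<in> {p. is_partition p \<and> perimeter p = n}"
    then have ne: "p \<noteq> []" and pos: "\<forall>x\<in>set p. x > 0"
      and per: "Max (set p) + length p - 1 = n"
      by (auto simp: is_partition_def perimeter_def)
    from ne have "Max (set p) \<in> set p" by simp
    with pos have "Max (set p) > 0" by blast
    moreover from ne have "length p > 0" by simp
    ultimately have "length p \<le> n" "Max (set p) \<le> n" using per by linarith+
    moreover have "\<forall>x\<in>set p. x \<le> Max (set p)" by simp
    ultimately show "p \<in> {p. set p \<subseteq> {..n} \<and> length p \<le> n}"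
      by (auto intro: le_trans[where j = "Max (set p)"])
  qed
  show "finite {p. set p \<subseteq> {..n} \<and> length p \<le> n}"
    by (rule finite_lists_length_le) simp
qed

end

theory Submission
  imports Defs
begin

text \<open>
  Both counts are instances of one problem: fix a predicate \<open>P\<close> that alternates along the
  natural numbers (\<open>even\<close> for \<open>red\<close>, \<open>odd\<close> for \<open>rod\<close>) and count the partitions of perimeter
  \<open>n\<close> in which no part satisfying \<open>P\<close> is repeated.  Split these according to whether the largest
  part is free to repeat (\<open>\<not> P\<close>) or not; call the two counts \<open>F n\<close> and \<open>D n\<close>.
  Removing a repeated copy of the largest part, or lowering a single largest part by one, lowers
  the perimeter by one.  The second operation switches whether the largest part may repeat, since
  \<open>P\<close> alternates; it fails only if it would repeat a part that must not repeat, and then the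
  largest part is removed altogether, at the cost of two.  This gives, for \<open>n \<ge> 2\<close>,
  \<open>D n = F (n - 1)\<close> (lemma \<open>card_top_single\<close>) and
  \<open>F n = F (n - 1) + D (n - 1) + D (n - 2)\<close> (lemma \<open>card_top_free\<close>), hence the tribonacci
  recurrence \<open>F n = F (n - 1) + F (n - 2) + F (n - 3)\<close> for \<open>n \<ge> 4\<close>.

  The recurrence is the same for \<open>even\<close> and \<open>odd\<close>; only the starting values differ, because the
  sole partition \<open>[1]\<close> of perimeter 1 has a free largest part in the first case and not in the
  second.  So \<open>F\<close> starts with 1, 1, 2 for \<open>even\<close> and with 0, 1, 2 for \<open>odd\<close>.  The surplus
  of 1 at the beginning spreads through the recurrence and makes \<open>F\<close> strictly larger for \<open>even\<close>
  from \<open>n = 4\<close> on.  As the total count is \<open>F n + F (n - 1)\<close>, the inequality follows.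
\<close>

definition parts_distinct_on :: "(nat \<Rightarrow> bool) \<Rightarrow> nat list \<Rightarrow> bool" where
  "parts_distinct_on P p \<longleftrightarrow> (\<forall>x\<in>set p. P x \<longrightarrow> count_list p x = 1)"

definition top_free :: "(nat \<Rightarrow> bool) \<Rightarrow> nat \<Rightarrow> nat list set" where
  "top_free P n =
    {p. is_partition p \<and> perimeter p = n \<and> parts_distinct_on P p \<and> \<not> P (hd p)}"

definition top_single :: "(nat \<Rightarrow> bool) \<Rightarrow> nat \<Rightarrow> nat list set" where
  "top_single P n =
    {p. is_partition p \<and> perimeter p = n \<and> parts_distinct_on P p \<and> P (hd p)}"

lemma is_partition_Cons:
  "is_partition (a # q) \<longleftrightarrow>
    a > 0 \<and> (\<forall>x\<in>set q. x \<le> a) \<and> (q = [] \<or> is_partition q)"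
  by (auto simp: is_partition_def)

lemma perimeter_Cons:
  assumes "is_partition (a # q)"
  shows "perimeter (a # q) = a + length q"
proof -
  have "Max (set (a # q)) = a"
    using assms by (intro Max_eqI) (auto simp: is_partition_Cons)
  then show ?thesis by (simp add: perimeter_def)
qed

lemma parts_distinct_on_Cons:
  "parts_distinct_on P (a # q) \<longleftrightarrow> (P a \<longrightarrow> a \<notin> set q) \<and> parts_distinct_on P q"
  by (auto simp: parts_distinct_on_def count_list_0_iff)

lemma mem_top_free_Cons:
  "a # q \<in> top_free P n \<longleftrightarrow>
    is_partition (a # q) \<and> a + length q = n \<and> parts_distinct_on P q \<and> \<not> P a"
  by (auto simp: top_free_def perimeter_Cons parts_distinct_on_Cons)

lemma mem_top_single_Cons:
  "a # q \<in> top_single P n \<longleftrightarrow>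
    is_partition (a # q) \<and> a + length q = n \<and> parts_distinct_on P q \<and> P a \<and> a \<notin> set q"
  by (auto simp: top_single_def perimeter_Cons parts_distinct_on_Cons)

lemma Nil_notin_top [simp]: "[] \<notin> top_free P n" "[] \<notin> top_single P n"
  by (auto simp: top_free_def top_single_def is_partition_def)

lemma finite_top [simp]: "finite (top_free P n)" "finite (top_single P n)"
  by (auto simp: top_free_def top_single_def
      intro: finite_subset [OF _ finite_partitions_perimeter [of n]])

lemma card_parts_distinct_on:
  "card {p. is_partition p \<and> perimeter p = n \<and> parts_distinct_on P p} =
    card (top_free P n) + card (top_single P n)"
proof -
  have "{p. is_partition p \<and> perimeter p = n \<and> parts_distinct_on P p} =
      top_free P n \<union> top_single P n"
    by (auto simp: top_free_def top_single_def)
  moreover have "top_free P n \<inter> top_single P n = {}"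
    by (auto simp: top_free_def top_single_def)
  ultimately show ?thesis by (simp add: card_Un_disjoint)
qed

section \<open>Recurrences for the two kinds of largest part\<close>

text \<open>
  A largest part \<open>a \<ge> 2\<close> that must not repeat occurs once, so lowering it by one leaves it a
  largest part; now it is free, and hence may coincide with later parts without restriction.
  The hypothesis \<open>n > 0\<close> excludes the partition \<open>[1]\<close>, whose largest part cannot be lowered.
\<close>

lemma card_top_single:
  assumes alt: "\<And>k. P (Suc k) \<longleftrightarrow> \<not> P k" and "n > 0"
  shows "card (top_single P (Suc n)) = card (top_free P n)"
proof -
  define up where "up = (\<lambda>p::nat list. Suc (hd p) # tl p)"
  have "top_single P (Suc n) = up ` top_free P n"
  proof (intro set_eqI iffI)
    fix p assume p: "p \<in> top_single P (Suc n)"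
    then obtain a q where pq: "p = a # q"
      by (cases p) auto
    have "a > 1"
    proof (cases q)
      case Nil
      with p pq \<open>n > 0\<close> show ?thesis by (simp add: mem_top_single_Cons)
    next
      case (Cons b r)
      with p pq have "0 < b" "b \<le> a" "b \<noteq> a"
        by (auto simp: mem_top_single_Cons is_partition_Cons)
      then show ?thesis by simp
    qed
    then obtain b where b: "a = Suc b" "b > 0" by (cases a) auto
    have "x \<le> b" if "x \<in> set q" for x
    proof -
      have "x \<le> a" "x \<noteq> a"
        using p that by (auto simp: pq mem_top_single_Cons is_partition_Cons)
      then show ?thesis using b by simp
    qed
    then have "b # q \<in> top_free P n"
      using p b by (auto simp: pq mem_top_single_Cons mem_top_free_Cons is_partition_Cons alt)
    then show "p \<in> up ` top_free P n"
      by (rule rev_image_eqI) (simp add: up_def pq b)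
  next
    fix p assume "p \<in> up ` top_free P n"
    then obtain p' where p': "p' \<in> top_free P n" "p = up p'" by blast
    then obtain a q where "p' = a # q"
      by (cases p') auto
    with p' have "a # q \<in> top_free P n" "p = Suc a # q" by (simp_all add: up_def)
    then show "p \<in> top_single P (Suc n)"
      by (fastforce simp: mem_top_single_Cons mem_top_free_Cons is_partition_Cons alt)
  qed
  moreover have "inj_on up (top_free P n)"
    unfolding up_def inj_on_def
    by (metis list.collapse list.inject nat.inject Nil_notin_top(1))
  ultimately show ?thesis by (simp add: card_image)
qed

text \<open>
  Let the largest part \<open>a\<close> be free.  If it repeats, one copy can be removed.  Otherwise the part
  \<open>a - 1\<close> is not free, so it occurs at most once: if it does not occur, \<open>a\<close> can be lowered to
  \<open>a - 1\<close>, and if it occurs, \<open>a\<close> is removed instead, which lowers the perimeter by two.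
\<close>

lemma card_top_free:
  assumes alt: "\<And>k. P (Suc k) \<longleftrightarrow> \<not> P k"
  shows "card (top_free P (Suc (Suc n))) =
    card (top_free P (Suc n)) + card (top_single P (Suc n)) + card (top_single P n)"
proof -
  define dup where "dup = (\<lambda>p::nat list. hd p # p)"
  define up where "up = (\<lambda>p::nat list. Suc (hd p) # tl p)"
  define new where "new = (\<lambda>p::nat list. Suc (hd p) # p)"
  let ?A = "dup ` top_free P (Suc n)"
  let ?B = "up ` top_single P (Suc n)"
  let ?C = "new ` top_single P n"
  have A: "\<exists>a q. p = a # a # q \<and> a # q \<in> top_free P (Suc n)" if p: "p \<in> ?A" for p
  proof -
    obtain p' where p': "p' \<in> top_free P (Suc n)" "p = dup p'" using p by blast
    then show ?thesis by (cases p') (auto simp: dup_def)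
  qed
  have B: "\<exists>a q. p = Suc a # q \<and> a # q \<in> top_single P (Suc n)" if p: "p \<in> ?B" for p
  proof -
    obtain p' where p': "p' \<in> top_single P (Suc n)" "p = up p'" using p by blast
    then show ?thesis by (cases p') (auto simp: up_def)
  qed
  have C: "\<exists>a q. p = Suc a # a # q \<and> a # q \<in> top_single P n" if p: "p \<in> ?C" for p
  proof -
    obtain p' where p': "p' \<in> top_single P n" "p = new p'" using p by blast
    then show ?thesis by (cases p') (auto simp: new_def)
  qed
  have "top_free P (Suc (Suc n)) = ?A \<union> ?B \<union> ?C"
  proof (intro set_eqI iffI)
    fix p assume p: "p \<in> top_free P (Suc (Suc n))"
    then obtain a q where pq: "p = a # q"
      by (cases p) auto
    show "p \<in> ?A \<union> ?B \<union> ?C"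
    proof (cases "q \<noteq> [] \<and> hd q = a")
      case True
      then obtain r where r: "q = a # r" by (cases q) auto
      with p pq have "a # r \<in> top_free P (Suc n)"
        by (auto simp: mem_top_free_Cons is_partition_Cons parts_distinct_on_Cons)
      then show ?thesis by (auto simp: pq r dup_def intro: rev_image_eqI)
    next
      case False
      have lt: "x < a" if x: "x \<in> set q" for x
      proof -
        obtain b r where br: "q = b # r" using x by (cases q) auto
        with False p pq x show ?thesis
          by (fastforce simp: mem_top_free_Cons is_partition_Cons)
      qed
      have "a > 1"
      proof (cases q)
        case Nil
        with p pq show ?thesis by (simp add: mem_top_free_Cons)
      next
        case (Cons b r)
        with lt [of b] p pq show ?thesis
          by (simp add: mem_top_free_Cons is_partition_Cons)
      qed
      then obtain b where b: "a = Suc b" "b > 0" by (cases a) auto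
      show ?thesis
      proof (cases "b \<in> set q")
        case True
        then obtain c r where cr: "q = c # r" by (cases q) auto
        \<comment> \<open>The second entry \<open>c\<close> is squeezed between the later entry \<open>b\<close> and \<open>a = Suc b\<close>.\<close>
        have "c = b"
          using True lt [of c] p by (fastforce simp: pq cr b mem_top_free_Cons is_partition_Cons)
        with p have "b # r \<in> top_single P n"
          by (auto simp: pq cr b alt mem_top_free_Cons mem_top_single_Cons is_partition_Cons
              parts_distinct_on_Cons)
        then show ?thesis
          by (auto simp: pq b cr \<open>c = b\<close> new_def intro: rev_image_eqI)
      next
        case False
        with p lt have "b # q \<in> top_single P (Suc n)"
          by (auto simp: pq b alt less_Suc_eq_le mem_top_free_Cons mem_top_single_Cons
              is_partition_Cons)
        then show ?thesis by (auto simp: pq b up_def intro: rev_image_eqI)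
      qed
    qed
  next
    fix p assume "p \<in> ?A \<union> ?B \<union> ?C"
    then consider "p \<in> ?A" | "p \<in> ?B" | "p \<in> ?C" by blast
    then show "p \<in> top_free P (Suc (Suc n))"
    proof cases
      case 1
      then show ?thesis using A [OF 1]
        by (auto simp: mem_top_free_Cons is_partition_Cons parts_distinct_on_Cons)
    next
      case 2
      then show ?thesis using B [OF 2]
        by (auto simp: mem_top_free_Cons mem_top_single_Cons is_partition_Cons alt
            le_Suc_eq)
    next
      case 3
      then show ?thesis using C [OF 3]
        by (auto simp: mem_top_free_Cons mem_top_single_Cons is_partition_Cons alt
            parts_distinct_on_Cons le_Suc_eq)
    qed
  qed
  \<comment> \<open>The first two entries of \<open>p\<close> tell the cases apart: they are equal in \<open>?A\<close>, they differ
    by exactly one in \<open>?C\<close>, and in \<open>?B\<close> they differ by more or there is no second entry.\<close>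
  moreover have "?A \<inter> ?B = {}"
    using A B by (fastforce simp: mem_top_single_Cons is_partition_Cons)
  moreover have "(?A \<union> ?B) \<inter> ?C = {}"
    using A B C by (fastforce simp: mem_top_single_Cons is_partition_Cons)
  moreover have "inj_on dup (top_free P (Suc n))"
    unfolding dup_def inj_on_def by simp
  moreover have "inj_on up (top_single P (Suc n))"
    unfolding up_def inj_on_def
    by (metis list.collapse list.inject nat.inject Nil_notin_top(2))
  moreover have "inj_on new (top_single P n)"
    unfolding new_def inj_on_def by simp
  ultimately show ?thesis by (simp add: card_Un_disjoint card_image)
qed

section \<open>Starting values and comparison\<close>

lemma top_single_0: "top_single P 0 = {}"
proof -
  have "p \<notin> top_single P 0" for p
    by (cases p) (auto simp: mem_top_single_Cons is_partition_Cons)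
  then show ?thesis by blast
qed

lemma top_1:
  "top_free P 1 = (if P 1 then {} else {[1]})"
  "top_single P 1 = (if P 1 then {[1]} else {})"
proof -
  have "p \<in> top_free P 1 \<longleftrightarrow> p = [1] \<and> \<not> P 1" for p
    by (cases p; cases "tl p")
      (auto simp: mem_top_free_Cons is_partition_Cons parts_distinct_on_def)
  then show "top_free P 1 = (if P 1 then {} else {[1]})" by auto
  have "p \<in> top_single P 1 \<longleftrightarrow> p = [1] \<and> P 1" for p
    by (cases p; cases "tl p")
      (auto simp: mem_top_single_Cons is_partition_Cons parts_distinct_on_def)
  then show "top_single P 1 = (if P 1 then {[1]} else {})" by auto
qed

lemma card_top_free_tribonacci:
  assumes alt: "\<And>k. P (Suc k) \<longleftrightarrow> \<not> P k" and "n > 0"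
  shows "card (top_free P (n + 3)) =
    card (top_free P (n + 2)) + card (top_free P (n + 1)) + card (top_free P n)"
  using card_top_free [of P "Suc n", OF alt] card_top_single [of P "Suc n", OF alt]
    card_top_single [of P n, OF alt] \<open>n > 0\<close>
  by (simp add: numeral_3_eq_3)

lemma card_top_free_start:
  assumes alt: "\<And>k. P (Suc k) \<longleftrightarrow> \<not> P k"
  shows "card (top_free P 1) = (if P 1 then 0 else 1)"
    "card (top_free P 2) = 1" "card (top_free P 3) = 2"
proof -
  show 1: "card (top_free P 1) = (if P 1 then 0 else 1)"
    unfolding top_1 by simp
  show 2: "card (top_free P 2) = 1"
    using card_top_free [of P 0, OF alt] top_1 [of P]
    by (auto simp: top_single_0 numeral_2_eq_2 split: if_splits)
  show "card (top_free P 3) = 2"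
    using card_top_free [of P 1, OF alt] card_top_single [of P 1, OF alt] 2 top_1 [of P]
    by (auto simp: numeral_2_eq_2 numeral_3_eq_3 split: if_splits)
qed

lemma card_top_free_odd_le_even:
  assumes "n > 0"
  shows "card (top_free odd n) \<le> card (top_free even n) \<and>
    (n \<ge> 4 \<longrightarrow> card (top_free odd n) < card (top_free even n))"
  using assms
proof (induction n rule: less_induct)
  case (less n)
  have alt: "even (Suc k) \<longleftrightarrow> \<not> even k" "odd (Suc k) \<longleftrightarrow> \<not> odd k" for k :: nat
    by auto
  show ?case
  proof (cases "n \<ge> 4")
    case False
    with less.prems consider "n = 1" | "n = 2" | "n = 3" by linarith
    then show ?thesis
      by cases (use card_top_free_start [of even, OF alt(1)]
          card_top_free_start [of odd, OF alt(2)] in simp_all)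
  next
    case True
    define m where "m = n - 3"
    have n: "n = m + 3" "m > 0" using True by (auto simp: m_def)
    note rec = card_top_free_tribonacci [of even m, OF alt(1) n(2)]
      card_top_free_tribonacci [of odd m, OF alt(2) n(2)]
    note IH = less.IH [of m] less.IH [of "m + 1"] less.IH [of "m + 2"]
    show ?thesis
    proof (cases "m = 1")
      case True
      \<comment> \<open>The strict inequality has its source in the values at 1.\<close>
      then have "card (top_free odd m) < card (top_free even m)"
        using card_top_free_start(1) [of even, OF alt(1)]
          card_top_free_start(1) [of odd, OF alt(2)] by simp
      with IH rec n show ?thesis by auto
    next
      case False
      with IH rec n show ?thesis by auto
    qed
  qed
qed

theorem corollary1p7:
  fixes n :: nat
  assumes "n \<ge> 4 \<or> n = 2"
  shows "red n > rod n"
proof -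
  have alt: "even (Suc k) \<longleftrightarrow> \<not> even k" "odd (Suc k) \<longleftrightarrow> \<not> odd k" for k :: nat
    by auto
  obtain m where m: "n = Suc m" "m > 0" using assms by (cases n) auto
  have "red n = card (top_free even n) + card (top_free even m)"
    using card_parts_distinct_on [of n even] card_top_single [of even m, OF alt(1) m(2)]
    by (simp add: red_def even_parts_distinct_def parts_distinct_on_def m)
  moreover have "rod n = card (top_free odd n) + card (top_free odd m)"
    using card_parts_distinct_on [of n odd] card_top_single [of odd m, OF alt(2) m(2)]
    by (simp add: rod_def odd_parts_distinct_def parts_distinct_on_def m)
  moreover have "card (top_free odd n) + card (top_free odd m) <
      card (top_free even n) + card (top_free even m)"
  proof (cases "n = 2")
    case True
    then show ?thesis
      using m card_top_free_start [of even, OF alt(1)] card_top_free_start [of odd, OF alt(2)]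
      by (simp add: numeral_2_eq_2)
  next
    case False
    then show ?thesis
      using assms card_top_free_odd_le_even [of n] card_top_free_odd_le_even [of m] m by auto
  qed
  ultimately show ?thesis by simp
qed

end
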